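(* Let $(B,+,\cdot)$ be a skew left brace with additive group $K$ and multiplicative group $C$, and let $(G,K,H,E)$ be a trifactorised group associated with $(B,+,\cdot)$. Then the map $L\mapsto LH\cap LE$ is a bijection between the set of subbraces of $(B,+,\cdot)$ and the set of trifactorised subgroups of $(G,K,H,E)$. Furthermore, the restriction of this map to the set of all ideals of $B$ defines a bijection between the set of all ideals of $B$ and the set of all normal trifactorised subgroups of $G$ (i.e. trifactorised subgroups that are normal in $G$).
   Context: A skew left brace $(B,+,\cdot)$ is a set with two group operations ($+$ not necessarily commutative) such that $a(b+c)=ab-a+ac$ for all $a,b,c\in B$. Its lambda map is the homomorphism $\lambda\colon (B,\cdot)\to\operatorname{Aut}(B,+)$, $\lambda_a(b)=-a+ab$. A subbrace is a subset that is a subgroup of both $(B,+)$ and $(B,\cdot)$. An ideal is a subset $L$ that is a normal subgroup of $(B,+)$ and of $(B,\cdot)$ with $\lambda_a(L)\subseteq L$ for all $a\in B$. A trifactorised group is a tuple $(G,K,H,E)$ with $G$ a group, $K\trianglelefteq G$, $H,E\le G$, $G=KE=KH=HE$ and $K\cap E=H\cap E=1$. A subgroup $T$ of $G$ is a trifactorised subgroup of $(G,K,H,E)$ if $(T,T\cap K,T\cap H,T\cap E)$ is a trifactorised group. Trifactorised groups associated with a brace: let $K=(B,+)$, $C=(B,\cdot)$, let $\delta\colon C\to K$ be the identity map of $B$, and let $\eta\colon C\to E$ be a surjective group homomorphism with $\ker\eta\le\ker\lambda$. Then $E$ acts on $K$ by $\bar\lambda(\eta(c))=\lambda(c)$; put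 $G=K\rtimes E$ (with $K$, $E$ identified with their copies in $G$, so subsets of $B$ are subsets of $K\le G$) and $H=\{\delta(c)\eta(c)\mid c\in C\}\le G$. The tuple $(G,K,H,E)$ is a trifactorised group associated with $B$. *)

theory Defs
  imports "HOL-Algebra.Bij" "HOL-Algebra.Coset" "HOL-Algebra.Ring"
begin

section \<open>Skew left braces\<close>

text \<open>
  The two operations of a skew left brace are carried by the ring record: \<open>\<oplus>\<close> and \<open>\<zero>\<close>
  belong to the additive group \<open>add_monoid B\<close>, which need not be commutative, and \<open>\<otimes>\<close> and
  \<open>\<one>\<close> to the multiplicative group, which is \<open>B\<close> itself viewed as a monoid record.
  The groups share their carrier, so the map \<open>\<delta>\<close> from the multiplicative to the additive
  group is literally the identity and is not written.
\<close>

locale skew_left_brace = fixes B (structure)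
  assumes add_group: "group (add_monoid B)"
    and mult_group: "group B"
    and brace_distrib: "\<lbrakk>a \<in> carrier B; b \<in> carrier B; c \<in> carrier B\<rbrakk>
      \<Longrightarrow> a \<otimes> (b \<oplus> c) = ((a \<otimes> b) \<ominus> a) \<oplus> (a \<otimes> c)"

text \<open>Restricted to the carrier because the elements of \<open>AutoGroup\<close> are extensional functions.\<close>

definition brace_lambda :: "('b, 'm) ring_scheme \<Rightarrow> 'b \<Rightarrow> 'b \<Rightarrow> 'b"
  where "brace_lambda B a = (\<lambda>b \<in> carrier B. (\<ominus>\<^bsub>B\<^esub> a) \<oplus>\<^bsub>B\<^esub> (a \<otimes>\<^bsub>B\<^esub> b))"

definition subbrace :: "'b set \<Rightarrow> ('b, 'm) ring_scheme \<Rightarrow> bool"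
  where "subbrace L B \<longleftrightarrow> subgroup L (add_monoid B) \<and> subgroup L B"

definition brace_ideal :: "'b set \<Rightarrow> ('b, 'm) ring_scheme \<Rightarrow> bool"
  where "brace_ideal L B \<longleftrightarrow> L \<lhd> add_monoid B \<and> L \<lhd> B
    \<and> (\<forall>a \<in> carrier B. brace_lambda B a ` L \<subseteq> L)"


section \<open>Trifactorised groups\<close>

definition trifactorised_group ::
    "('g, 'n) monoid_scheme \<Rightarrow> 'g set \<Rightarrow> 'g set \<Rightarrow> 'g set \<Rightarrow> bool"
  where "trifactorised_group G K H E \<longleftrightarrow>
    group G \<and> K \<lhd> G \<and> subgroup H G \<and> subgroup E G \<and>
    carrier G = K <#>\<^bsub>G\<^esub> E \<and> carrier G = K <#>\<^bsub>G\<^esub> H \<and> carrier G = H <#>\<^bsub>G\<^esub> E \<and>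
    K \<inter> E = {\<one>\<^bsub>G\<^esub>} \<and> H \<inter> E = {\<one>\<^bsub>G\<^esub>}"

definition trifactorised_subgroup ::
    "'g set \<Rightarrow> ('g, 'n) monoid_scheme \<Rightarrow> 'g set \<Rightarrow> 'g set \<Rightarrow> 'g set \<Rightarrow> bool"
  where "trifactorised_subgroup T G K H E \<longleftrightarrow>
    subgroup T G \<and> trifactorised_group (G\<lparr>carrier := T\<rparr>) (T \<inter> K) (T \<inter> H) (T \<inter> E)"


section \<open>Trifactorised groups associated with a skew left brace\<close>

definition semidirect_product ::
    "('k, 'm) monoid_scheme \<Rightarrow> ('e, 'n) monoid_scheme \<Rightarrow> ('e \<Rightarrow> 'k \<Rightarrow> 'k) \<Rightarrow> ('k \<times> 'e) monoid"
  where "semidirect_product K E \<phi> =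
    \<lparr>carrier = carrier K \<times> carrier E,
     mult = (\<lambda>(k, e) (k', e'). (k \<otimes>\<^bsub>K\<^esub> \<phi> e k', e \<otimes>\<^bsub>E\<^esub> e')),
     one = (\<one>\<^bsub>K\<^esub>, \<one>\<^bsub>E\<^esub>)\<rparr>"

locale brace_trifactorisation = skew_left_brace B + E: group E
  for B (structure) and E and \<eta> +
  assumes \<eta>_hom: "\<eta> \<in> hom B E"
    and \<eta>_surj: "\<eta> ` carrier B = carrier E"
    and \<eta>_kernel: "kernel B E \<eta> \<subseteq> kernel B (AutoGroup (add_monoid B)) (brace_lambda B)"

text \<open>
  The action of \<open>E\<close> on the additive group sends \<open>\<eta> c\<close> to \<open>brace_lambda B c\<close>. It is independent
  of the chosen preimage \<open>c\<close>; see \<open>assoc_action_eq\<close> below.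
\<close>

definition assoc_action :: "('b, 'm) ring_scheme \<Rightarrow> ('b \<Rightarrow> 'e) \<Rightarrow> 'e \<Rightarrow> 'b \<Rightarrow> 'b"
  where "assoc_action B \<eta> e = brace_lambda B (inv_into (carrier B) \<eta> e)"

definition assoc_group ::
    "('b, 'm) ring_scheme \<Rightarrow> ('e, 'n) monoid_scheme \<Rightarrow> ('b \<Rightarrow> 'e) \<Rightarrow> ('b \<times> 'e) monoid"
  where "assoc_group B E \<eta> = semidirect_product (add_monoid B) E (assoc_action B \<eta>)"

text \<open>The embeddings by which subsets of \<open>B\<close> and of \<open>E\<close> are regarded as subsets of the group.\<close>

definition embed_add :: "('e, 'n) monoid_scheme \<Rightarrow> 'b \<Rightarrow> 'b \<times> 'e"
  where "embed_add E b = (b, \<one>\<^bsub>E\<^esub>)"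

definition embed_quot :: "('b, 'm) ring_scheme \<Rightarrow> 'e \<Rightarrow> 'b \<times> 'e"
  where "embed_quot B e = (\<zero>\<^bsub>B\<^esub>, e)"

definition assoc_K :: "('b, 'm) ring_scheme \<Rightarrow> ('e, 'n) monoid_scheme \<Rightarrow> ('b \<times> 'e) set"
  where "assoc_K B E = embed_add E ` carrier B"

definition assoc_E :: "('b, 'm) ring_scheme \<Rightarrow> ('e, 'n) monoid_scheme \<Rightarrow> ('b \<times> 'e) set"
  where "assoc_E B E = embed_quot B ` carrier E"

definition assoc_H ::
    "('b, 'm) ring_scheme \<Rightarrow> ('e, 'n) monoid_scheme \<Rightarrow> ('b \<Rightarrow> 'e) \<Rightarrow> ('b \<times> 'e) set"
  where "assoc_H B E \<eta> =
    {embed_add E c \<otimes>\<^bsub>assoc_group B E \<eta>\<^esub> embed_quot B (\<eta> c) | c. c \<in> carrier B}"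


section \<open>The construction is well defined\<close>

context skew_left_brace
begin

sublocale A: group "add_monoid B"
  rewrites "carrier (add_monoid B) = carrier B"
    and "mult (add_monoid B) = add B"
    and "one (add_monoid B) = zero B"
    and "m_inv (add_monoid B) = a_inv B"
  by (rule add_group) (auto simp: a_inv_def)

sublocale M: group B
  by (rule mult_group)

lemma one_eq_zero: "\<one> = \<zero>"
proof -
  have "\<one> \<otimes> (\<zero> \<oplus> \<zero>) = ((\<one> \<otimes> \<zero>) \<ominus> \<one>) \<oplus> (\<one> \<otimes> \<zero>)"
    by (rule brace_distrib) auto
  then have "\<ominus> \<one> = \<zero>"
    by (simp add: a_minus_def)
  then show ?thesis
    by (metis A.inv_inv A.inv_one M.one_closed)
qed

lemma mult_eq_add_lambda:
  assumes "a \<in> carrier B" "b \<in> carrier B"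
  shows "a \<otimes> b = a \<oplus> brace_lambda B a b"
  using assms by (simp add: brace_lambda_def A.m_assoc [symmetric])

lemma lambda_closed:
  "\<lbrakk>a \<in> carrier B; b \<in> carrier B\<rbrakk> \<Longrightarrow> brace_lambda B a b \<in> carrier B"
  by (simp add: brace_lambda_def)

lemma lambda_add:
  assumes "a \<in> carrier B" "b \<in> carrier B" "c \<in> carrier B"
  shows "brace_lambda B a (b \<oplus> c) = brace_lambda B a b \<oplus> brace_lambda B a c"
  using assms by (simp add: brace_lambda_def brace_distrib a_minus_def A.m_assoc)

lemma lambda_mult:
  assumes "a \<in> carrier B" "b \<in> carrier B" "c \<in> carrier B"
  shows "brace_lambda B (a \<otimes> b) c = brace_lambda B a (brace_lambda B b c)"
proof -
  have "(a \<otimes> b) \<oplus> brace_lambda B (a \<otimes> b) c = a \<otimes> (b \<otimes> c)"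
    using assms by (simp add: mult_eq_add_lambda [symmetric] M.m_assoc)
  also have "\<dots> = a \<oplus> brace_lambda B a (b \<oplus> brace_lambda B b c)"
    using assms by (metis mult_eq_add_lambda M.m_closed)
  also have "\<dots> = (a \<otimes> b) \<oplus> brace_lambda B a (brace_lambda B b c)"
    using assms by (simp add: lambda_add lambda_closed A.m_assoc [symmetric] mult_eq_add_lambda)
  finally show ?thesis
    using assms by (simp add: lambda_closed)
qed

lemma lambda_one: "b \<in> carrier B \<Longrightarrow> brace_lambda B \<one> b = b"
  by (simp add: brace_lambda_def one_eq_zero [symmetric])
     (simp add: one_eq_zero)

lemma lambda_auto:
  assumes "a \<in> carrier B"
  shows "brace_lambda B a \<in> auto (add_monoid B)"
proof -
  have "bij_betw (brace_lambda B a) (carrier B) (carrier B)"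
  proof (rule bij_betw_byWitness [where f' = "brace_lambda B (inv a)"])
    show "\<forall>b \<in> carrier B. brace_lambda B (inv a) (brace_lambda B a b) = b"
      using assms by (simp add: lambda_mult [symmetric] lambda_one)
    show "\<forall>b \<in> carrier B. brace_lambda B a (brace_lambda B (inv a) b) = b"
      using assms by (simp add: lambda_mult [symmetric] lambda_one)
  qed (use assms in \<open>auto simp: lambda_closed\<close>)
  moreover have "brace_lambda B a \<in> extensional (carrier B)"
    by (simp add: brace_lambda_def)
  ultimately show ?thesis
    using assms by (auto simp: auto_def Bij_def hom_def lambda_add lambda_closed)
qed

lemma lambda_hom: "brace_lambda B \<in> hom B (AutoGroup (add_monoid B))"
proof (rule homI)
  fix a b assume ab: "a \<in> carrier B" "b \<in> carrier B"
  have "brace_lambda B a \<in> Bij (carrier B)" "brace_lambda B b \<in> Bij (carrier B)"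
    using lambda_auto [OF ab(1)] lambda_auto [OF ab(2)] by (auto simp: auto_def)
  moreover have "brace_lambda B (a \<otimes> b) = compose (carrier B) (brace_lambda B a) (brace_lambda B b)"
    using ab by (intro extensionalityI [where A = "carrier B"])
      (auto simp: lambda_mult compose_def, simp add: brace_lambda_def)
  ultimately show "brace_lambda B (a \<otimes> b) =
      brace_lambda B a \<otimes>\<^bsub>AutoGroup (add_monoid B)\<^esub> brace_lambda B b"
    by (simp add: AutoGroup_def BijGroup_def)
qed (simp add: AutoGroup_def lambda_auto)

end

lemma brace_ideal_imp_subbrace: "brace_ideal L B \<Longrightarrow> subbrace L B"
  by (simp add: brace_ideal_def subbrace_def normal_imp_subgroup)

context brace_trifactorisation
begin

sublocale eta: group_hom B E \<eta>
  by unfold_locales (rule \<eta>_hom)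

lemma assoc_action_eq:
  assumes c: "c \<in> carrier B"
  shows "assoc_action B \<eta> (\<eta> c) = brace_lambda B c"
proof -
  define d where "d = inv_into (carrier B) \<eta> (\<eta> c)"
  have d: "d \<in> carrier B" "\<eta> d = \<eta> c"
    using c by (auto simp: d_def inv_into_into f_inv_into_f)
  have "inv c \<otimes> d \<in> kernel B E \<eta>"
    using c d by (simp add: kernel_def)
  then have "brace_lambda B (inv c \<otimes> d) = (\<lambda>x \<in> carrier B. x)"
    using \<eta>_kernel by (auto simp: kernel_def AutoGroup_def BijGroup_def)
  then have *: "brace_lambda B (inv c \<otimes> d) b = b" if "b \<in> carrier B" for b
    using that by simp
  have "brace_lambda B d b = brace_lambda B c b" for b
  proof (cases "b \<in> carrier B")
    case True
    have "brace_lambda B c (brace_lambda B (inv c \<otimes> d) b) = brace_lambda B d b"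
      using c d True by (simp add: lambda_mult [symmetric] M.m_assoc [symmetric])
    then show ?thesis
      by (simp add: * True)
  qed (simp add: brace_lambda_def)
  then show ?thesis
    by (auto simp: assoc_action_def d_def)
qed

lemma assoc_carrier: "carrier (assoc_group B E \<eta>) = carrier B \<times> carrier E"
  by (simp add: assoc_group_def semidirect_product_def)

lemma assoc_one: "\<one>\<^bsub>assoc_group B E \<eta>\<^esub> = (\<zero>, \<one>\<^bsub>E\<^esub>)"
  by (simp add: assoc_group_def semidirect_product_def)

lemma assoc_mult:
  "c \<in> carrier B \<Longrightarrow> (a, \<eta> c) \<otimes>\<^bsub>assoc_group B E \<eta>\<^esub> (b, e) = (a \<oplus> brace_lambda B c b, \<eta> c \<otimes>\<^bsub>E\<^esub> e)"
  by (simp add: assoc_group_def semidirect_product_def assoc_action_eq)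

lemma lambda_zero: "c \<in> carrier B \<Longrightarrow> brace_lambda B c \<zero> = \<zero>"
  using lambda_add [of c \<zero> \<zero>] by (simp add: lambda_closed)

lemma assoc_H_eq: "assoc_H B E \<eta> = {(c, \<eta> c) | c. c \<in> carrier B}"
proof -
  have "embed_add E c \<otimes>\<^bsub>assoc_group B E \<eta>\<^esub> embed_quot B (\<eta> c) = (c, \<eta> c)"
    if "c \<in> carrier B" for c
    using assoc_mult [of \<one> c \<zero> "\<eta> c"] that
    by (simp add: embed_add_def embed_quot_def lambda_one)
  then show ?thesis
    unfolding assoc_H_def by (intro Collect_cong ex_cong1) auto
qed

lemma assoc_group_is_group: "group (assoc_group B E \<eta>)"
proof (rule groupI)
  fix x y z
  assume "x \<in> carrier (assoc_group B E \<eta>)" "y \<in> carrier (assoc_group B E \<eta>)"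
    "z \<in> carrier (assoc_group B E \<eta>)"
  then obtain a b c a' b' c' where "x = (a, \<eta> a')" "y = (b, \<eta> b')" "z = (c, \<eta> c')"
    "a \<in> carrier B" "b \<in> carrier B" "c \<in> carrier B"
    "a' \<in> carrier B" "b' \<in> carrier B" "c' \<in> carrier B"
    by (auto simp: assoc_carrier \<eta>_surj [symmetric])
  then show "x \<otimes>\<^bsub>assoc_group B E \<eta>\<^esub> y \<otimes>\<^bsub>assoc_group B E \<eta>\<^esub> z =
      x \<otimes>\<^bsub>assoc_group B E \<eta>\<^esub> (y \<otimes>\<^bsub>assoc_group B E \<eta>\<^esub> z)"
    using assoc_mult [of "a' \<otimes> b'"]
    by (simp add: assoc_mult lambda_add lambda_closed lambda_mult A.m_assoc E.m_assoc)
next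
  fix x assume "x \<in> carrier (assoc_group B E \<eta>)"
  then obtain a a' where x: "x = (a, \<eta> a')" "a \<in> carrier B" "a' \<in> carrier B"
    by (auto simp: assoc_carrier \<eta>_surj [symmetric])
  then show "\<one>\<^bsub>assoc_group B E \<eta>\<^esub> \<otimes>\<^bsub>assoc_group B E \<eta>\<^esub> x = x"
    using assoc_mult [of \<one> \<zero> a "\<eta> a'"] by (simp add: assoc_one lambda_one)
  let ?y = "(brace_lambda B (inv a') (\<ominus> a), \<eta> (inv a'))"
  have "?y \<in> carrier (assoc_group B E \<eta>)"
    using x by (simp add: assoc_carrier lambda_closed del: eta.hom_inv)
  moreover have "?y \<otimes>\<^bsub>assoc_group B E \<eta>\<^esub> x = \<one>\<^bsub>assoc_group B E \<eta>\<^esub>"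
  proof -
    have "brace_lambda B (inv a') (\<ominus> a) \<oplus> brace_lambda B (inv a') a = \<zero>"
      using x by (simp add: lambda_add [symmetric] lambda_zero)
    moreover have "\<eta> (inv a') \<otimes>\<^bsub>E\<^esub> \<eta> a' = \<one>\<^bsub>E\<^esub>"
      using x by simp
    ultimately show ?thesis
      using x by (simp add: assoc_mult assoc_one del: eta.hom_inv)
  qed
  ultimately show "\<exists>y \<in> carrier (assoc_group B E \<eta>).
      y \<otimes>\<^bsub>assoc_group B E \<eta>\<^esub> x = \<one>\<^bsub>assoc_group B E \<eta>\<^esub>"
    by blast
next
  fix x y
  assume "x \<in> carrier (assoc_group B E \<eta>)" "y \<in> carrier (assoc_group B E \<eta>)"
  then show "x \<otimes>\<^bsub>assoc_group B E \<eta>\<^esub> y \<in> carrier (assoc_group B E \<eta>)"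
    by (auto simp: assoc_carrier \<eta>_surj [symmetric] assoc_mult lambda_closed
        eta.hom_mult [symmetric] simp del: eta.hom_mult)
qed (simp add: assoc_carrier assoc_one)

lemma assoc_trifactorised:
  "trifactorised_group (assoc_group B E \<eta>) (assoc_K B E) (assoc_H B E \<eta>) (assoc_E B E)"
proof -
  let ?G = "assoc_group B E \<eta>"
  interpret G: group ?G
    by (rule assoc_group_is_group)
  have K: "assoc_K B E = carrier B \<times> {\<one>\<^bsub>E\<^esub>}"
    by (auto simp: assoc_K_def embed_add_def)
  have E': "assoc_E B E = {\<zero>} \<times> carrier E"
    by (auto simp: assoc_E_def embed_quot_def)
  have one_mult: "(a, \<one>\<^bsub>E\<^esub>) \<otimes>\<^bsub>?G\<^esub> (b, e) = (a \<oplus> b, e)"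
    if "b \<in> carrier B" "e \<in> carrier E" for a b e
    using assoc_mult [of \<one> a b e] that by (simp add: lambda_one)
  have sndhom: "group_hom ?G E snd"
    by unfold_locales
      (auto simp: hom_def assoc_carrier assoc_group_def semidirect_product_def)
  have "kernel ?G E snd = assoc_K B E"
    by (auto simp: kernel_def assoc_carrier K)
  with group_hom.normal_kernel [OF sndhom] have nK: "assoc_K B E \<lhd> ?G"
    by simp
  have homH: "group_hom B ?G (\<lambda>c. (c, \<eta> c))"
    by unfold_locales
      (auto simp: hom_def assoc_carrier assoc_mult mult_eq_add_lambda [symmetric])
  have sH: "subgroup (assoc_H B E \<eta>) ?G"
    using group_hom.img_is_subgroup [OF homH]
    by (simp add: assoc_H_eq image_def setcompr_eq_image Setcompr_eq_image)
  have homE: "group_hom E ?G (\<lambda>e. (\<zero>, e))"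
    by unfold_locales
      (auto simp: hom_def assoc_carrier \<eta>_surj [symmetric] assoc_mult lambda_zero
        simp flip: eta.hom_mult)
  have sE: "subgroup (assoc_E B E) ?G"
    using group_hom.img_is_subgroup [OF homE] by (simp add: assoc_E_def embed_quot_def [abs_def])
  have sub: "assoc_K B E \<subseteq> carrier ?G" "assoc_H B E \<eta> \<subseteq> carrier ?G" "assoc_E B E \<subseteq> carrier ?G"
    by (auto simp: K E' assoc_H_eq assoc_carrier)
  have KE: "carrier ?G \<subseteq> assoc_K B E <#>\<^bsub>?G\<^esub> assoc_E B E"
  proof
    fix x assume "x \<in> carrier ?G"
    then obtain a e where x: "x = (a, e)" "a \<in> carrier B" "e \<in> carrier E"
      by (auto simp: assoc_carrier)
    then have "x = (a, \<one>\<^bsub>E\<^esub>) \<otimes>\<^bsub>?G\<^esub> (\<zero>, e)"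
      by (simp add: one_mult)
    then show "x \<in> assoc_K B E <#>\<^bsub>?G\<^esub> assoc_E B E"
      using x unfolding set_mult_def K E' by blast
  qed
  have KH: "carrier ?G \<subseteq> assoc_K B E <#>\<^bsub>?G\<^esub> assoc_H B E \<eta>"
  proof
    fix x assume "x \<in> carrier ?G"
    then obtain a c where x: "x = (a, \<eta> c)" "a \<in> carrier B" "c \<in> carrier B"
      by (auto simp: assoc_carrier \<eta>_surj [symmetric])
    then have "x = (a \<ominus> c, \<one>\<^bsub>E\<^esub>) \<otimes>\<^bsub>?G\<^esub> (c, \<eta> c)" "a \<ominus> c \<in> carrier B"
      by (auto simp: one_mult a_minus_def A.m_assoc)
    then show "x \<in> assoc_K B E <#>\<^bsub>?G\<^esub> assoc_H B E \<eta>"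
      using x unfolding set_mult_def K assoc_H_eq by blast
  qed
  have HE: "carrier ?G \<subseteq> assoc_H B E \<eta> <#>\<^bsub>?G\<^esub> assoc_E B E"
  proof
    fix x assume "x \<in> carrier ?G"
    then obtain a e where x: "x = (a, e)" "a \<in> carrier B" "e \<in> carrier E"
      by (auto simp: assoc_carrier)
    then have "x = (a, \<eta> a) \<otimes>\<^bsub>?G\<^esub> (\<zero>, inv\<^bsub>E\<^esub> (\<eta> a) \<otimes>\<^bsub>E\<^esub> e)"
      by (simp add: assoc_mult lambda_zero E.m_assoc [symmetric])
    moreover have "inv\<^bsub>E\<^esub> (\<eta> a) \<otimes>\<^bsub>E\<^esub> e \<in> carrier E"
      using x by simp
    ultimately show "x \<in> assoc_H B E \<eta> <#>\<^bsub>?G\<^esub> assoc_E B E"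
      using x unfolding set_mult_def E' assoc_H_eq by blast
  qed
  have "assoc_K B E \<inter> assoc_E B E = {\<one>\<^bsub>?G\<^esub>}"
    by (auto simp: K E' assoc_one)
  moreover have "assoc_H B E \<eta> \<inter> assoc_E B E = {\<one>\<^bsub>?G\<^esub>}"
    using eta.hom_one by (auto simp: E' assoc_H_eq assoc_one one_eq_zero)
  ultimately show ?thesis
    using nK sH sE KE KH HE G.set_mult_closed sub G.group_axioms
    unfolding trifactorised_group_def by (simp add: subset_antisym)
qed

end

end

theory Submission
  imports Defs
begin

text \<open>
  Every set \<open>\<Phi> L\<close> is a box. In coordinates \<open>(k, e)\<close> of the semidirect product, \<open>L E\<close> is
  \<open>L \<times> E\<close> and \<open>L H\<close> consists of the pairs \<open>(l + c, \<eta> c)\<close> with \<open>l\<close> in \<open>L\<close>. If \<open>L\<close> is an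
  additive subgroup, then \<open>l + c\<close> lies in \<open>L\<close> exactly when \<open>c\<close> does, so the intersection
  is \<open>L \<times> \<eta> L\<close> (\<open>LH_Int_LE_eq\<close>). Hence \<open>L\<close> is recovered as the first projection, and
  injectivity is immediate.

  For surjectivity, the factorisation \<open>T = (T \<inter> K) (T \<inter> E)\<close> makes a trifactorised subgroup \<open>T\<close>
  a box \<open>L \<times> F\<close>, and the two factorisations that involve \<open>H\<close>, the graph of \<open>\<eta>\<close>, give
  \<open>F = \<eta> L\<close> (\<open>trifactorised_subgroup_is_box\<close>). Such a box meets \<open>K\<close> in \<open>L\<close> and meets \<open>H\<close> in the
  graph of \<open>\<eta>\<close> over \<open>L\<close>. So \<open>L\<close> is at once the preimage of \<open>T\<close> under the additive
  homomorphism \<open>b \<mapsto> (b, 1)\<close> and under the multiplicative homomorphism \<open>c \<mapsto> (c, \<eta> c)\<close>.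
  Preimages of (normal) subgroups are (normal) subgroups, which yields the subbrace or ideal
  axioms for \<open>L\<close>; invariance under \<open>\<lambda>\<close> comes from conjugation by the elements of \<open>E\<close>.

  Conversely, the box over a subbrace is a subgroup whose elements have the required
  factorisations (\<open>box_trifactorised\<close>), and the box over an ideal is normal (\<open>box_normal\<close>).
\<close>

section \<open>Subgroups of groups and of trifactorised groups\<close>

lemma set_multI:
  "\<lbrakk>x = a \<otimes>\<^bsub>G\<^esub> b; a \<in> A; b \<in> B\<rbrakk> \<Longrightarrow> x \<in> A <#>\<^bsub>G\<^esub> B"
  by (auto simp: set_mult_def)

lemma (in group_hom) subgroup_preimage:
  assumes "subgroup T H"
  shows "subgroup {x \<in> carrier G. h x \<in> T} G"
proof (rule G.subgroupI)
  show "{x \<in> carrier G. h x \<in> T} \<noteq> {}"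
    using subgroup.one_closed [OF assms] hom_one by force
qed (use assms in \<open>auto simp: subgroup.m_inv_closed subgroup.m_closed\<close>)

lemma (in group_hom) normal_preimage:
  assumes "T \<lhd> H"
  shows "{x \<in> carrier G. h x \<in> T} \<lhd> G"
  using assms by (auto simp: G.normal_inv_iff H.normal_inv_iff subgroup_preimage)

text \<open>
  Normality of \<open>T \<inter> K\<close>, the subgroup conditions and the two trivial intersections are inherited
  by every subgroup \<open>T\<close>; only the three factorisations have to be tested.
\<close>

lemma trifactorised_subgroup_iff:
  assumes tri: "trifactorised_group G K H E" and T: "subgroup T G"
  shows "trifactorised_subgroup T G K H E \<longleftrightarrow>
    T \<subseteq> (T \<inter> K) <#>\<^bsub>G\<^esub> (T \<inter> E) \<and> T \<subseteq> (T \<inter> K) <#>\<^bsub>G\<^esub> (T \<inter> H) \<and> T \<subseteq> (T \<inter> H) <#>\<^bsub>G\<^esub> (T \<inter> E)"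
proof -
  interpret G: group G
    using tri by (simp add: trifactorised_group_def)
  have K: "K \<lhd> G" and H: "subgroup H G" and E: "subgroup E G"
    and triv: "K \<inter> E = {\<one>\<^bsub>G\<^esub>}" "H \<inter> E = {\<one>\<^bsub>G\<^esub>}"
    using tri by (auto simp: trifactorised_group_def)
  have one: "\<one>\<^bsub>G\<^esub> \<in> T"
    by (rule subgroup.one_closed [OF T])
  have sub: "subgroup (T \<inter> X) (G\<lparr>carrier := T\<rparr>)" if "subgroup X G" for X
    using that by (intro G.subgroup_incl G.subgroups_Inter_pair T) auto
  have "T \<inter> K \<lhd> G\<lparr>carrier := T\<rparr>"
    using G.normal_Int_subgroup [OF T K] by (simp add: Int_commute)
  moreover have "(T \<inter> X) <#>\<^bsub>G\<^esub> (T \<inter> Y) \<subseteq> T" for X Y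
    using subgroup.m_closed [OF T] by (auto simp: set_mult_def)
  moreover have "(T \<inter> K) \<inter> (T \<inter> E) = {\<one>\<^bsub>G\<^esub>}" "(T \<inter> H) \<inter> (T \<inter> E) = {\<one>\<^bsub>G\<^esub>}"
    using triv one by auto
  moreover have "A <#>\<^bsub>G\<lparr>carrier := T\<rparr>\<^esub> B = A <#>\<^bsub>G\<^esub> B" for A B
    by (simp add: set_mult_def)
  ultimately show ?thesis
    using T sub [OF H] sub [OF E] G.subgroup_imp_group [OF T]
    by (auto simp: trifactorised_subgroup_def trifactorised_group_def)
qed

section \<open>The associated group in coordinates\<close>

context brace_trifactorisation
begin

abbreviation assocG :: "('a \<times> 'c) monoid"
  where "assocG \<equiv> assoc_group B E \<eta>"

lemma assoc_K_eq: "assoc_K B E = carrier B \<times> {\<one>\<^bsub>E\<^esub>}"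
  by (auto simp: assoc_K_def embed_add_def)

lemma assoc_E_eq: "assoc_E B E = {\<zero>} \<times> carrier E"
  by (auto simp: assoc_E_def embed_quot_def)

lemma assoc_mult_add:
  "\<lbrakk>b \<in> carrier B; e \<in> carrier E\<rbrakk> \<Longrightarrow> (a, \<one>\<^bsub>E\<^esub>) \<otimes>\<^bsub>assocG\<^esub> (b, e) = (a \<oplus> b, e)"
  using assoc_mult [of \<one> a b e] by (simp add: lambda_one)

lemma assoc_mult_quot:
  "\<lbrakk>a \<in> carrier B; c \<in> carrier B; e \<in> carrier E\<rbrakk>
    \<Longrightarrow> (a, \<eta> c) \<otimes>\<^bsub>assocG\<^esub> (\<zero>, e) = (a, \<eta> c \<otimes>\<^bsub>E\<^esub> e)"
  by (simp add: assoc_mult lambda_zero)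

lemma assoc_elemE:
  assumes "x \<in> carrier assocG"
  obtains a c where "x = (a, \<eta> c)" "a \<in> carrier B" "c \<in> carrier B"
  using assms by (auto simp: assoc_carrier \<eta>_surj [symmetric])

lemma embed_add_group_hom: "group_hom (add_monoid B) assocG (embed_add E)"
  by (intro group_hom.intro group_hom_axioms.intro add_group assoc_group_is_group homI)
    (simp_all add: embed_add_def assoc_carrier assoc_mult_add)

lemma graph_group_hom: "group_hom B assocG (\<lambda>c. (c, \<eta> c))"
  by (intro group_hom.intro group_hom_axioms.intro mult_group assoc_group_is_group homI)
    (simp_all add: assoc_carrier assoc_mult mult_eq_add_lambda [symmetric])

text \<open>
  The additive subgroup property is what identifies the second coordinates: a pair
  \<open>(l + c, \<eta> c)\<close> of \<open>L H\<close> lies in \<open>L E\<close> only if \<open>c = - l + (l + c)\<close> is in \<open>L\<close>, and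
  conversely \<open>(a, \<eta> c)\<close> with \<open>a\<close> and \<open>c\<close> in \<open>L\<close> arises from \<open>l = a - c\<close>.
\<close>

lemma LH_Int_LE_eq:
  assumes L: "subgroup L (add_monoid B)"
  shows "(embed_add E ` L <#>\<^bsub>assocG\<^esub> assoc_H B E \<eta>) \<inter> (embed_add E ` L <#>\<^bsub>assocG\<^esub> assoc_E B E)
    = L \<times> \<eta> ` L"
proof -
  have LB: "L \<subseteq> carrier B"
    using subgroup.subset [OF L] by simp
  have add: "a \<oplus> b \<in> L" if "a \<in> L" "b \<in> L" for a b
    using subgroup.m_closed [OF L] that by simp
  have minus: "\<ominus> a \<in> L" if "a \<in> L" for a
    using subgroup.m_inv_closed [OF L] that by (simp add: a_inv_def)
  have LE: "embed_add E ` L <#>\<^bsub>assocG\<^esub> assoc_E B E = L \<times> carrier E"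
  proof -
    have "embed_add E ` L <#>\<^bsub>assocG\<^esub> assoc_E B E =
        (\<Union>l \<in> L. \<Union>e \<in> carrier E. {(l, \<one>\<^bsub>E\<^esub>) \<otimes>\<^bsub>assocG\<^esub> (\<zero>, e)})"
      by (auto simp: set_mult_def assoc_E_eq embed_add_def)
    also have "\<dots> = (\<Union>l \<in> L. \<Union>e \<in> carrier E. {(l, e)})"
      using LB by (intro SUP_cong refl) (auto simp: assoc_mult_add)
    finally show ?thesis by auto
  qed
  have LH: "embed_add E ` L <#>\<^bsub>assocG\<^esub> assoc_H B E \<eta> = {(l \<oplus> c, \<eta> c) | l c. l \<in> L \<and> c \<in> carrier B}"
  proof -
    have "embed_add E ` L <#>\<^bsub>assocG\<^esub> assoc_H B E \<eta> =
        (\<Union>l \<in> L. \<Union>c \<in> carrier B. {(l, \<one>\<^bsub>E\<^esub>) \<otimes>\<^bsub>assocG\<^esub> (c, \<eta> c)})"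
      by (auto simp: set_mult_def assoc_H_eq embed_add_def)
    also have "\<dots> = (\<Union>l \<in> L. \<Union>c \<in> carrier B. {(l \<oplus> c, \<eta> c)})"
      by (intro SUP_cong refl) (auto simp: assoc_mult_add)
    finally show ?thesis by auto
  qed
  have mem: "c \<in> L" if "l \<in> L" "c \<in> carrier B" "l \<oplus> c \<in> L" for l c
  proof -
    have "c = \<ominus> l \<oplus> (l \<oplus> c)"
      using that LB by (simp add: A.m_assoc [symmetric] subset_eq)
    then show ?thesis
      using add minus that by metis
  qed
  have "(a, \<eta> c) \<in> embed_add E ` L <#>\<^bsub>assocG\<^esub> assoc_H B E \<eta>" if "a \<in> L" "c \<in> L" for a c
  proof -
    have "a = (a \<oplus> \<ominus> c) \<oplus> c" "a \<oplus> \<ominus> c \<in> L" "c \<in> carrier B"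
      using that LB add minus by (auto simp: A.m_assoc subset_eq)
    then show ?thesis
      unfolding LH by blast
  qed
  then have "L \<times> \<eta> ` L \<subseteq> embed_add E ` L <#>\<^bsub>assocG\<^esub> assoc_H B E \<eta>"
    by auto
  moreover have "L \<times> \<eta> ` L \<subseteq> L \<times> carrier E"
    using LB by auto
  moreover have "x \<in> L \<times> \<eta> ` L"
    if "x \<in> embed_add E ` L <#>\<^bsub>assocG\<^esub> assoc_H B E \<eta>" "x \<in> L \<times> carrier E" for x
    using that mem unfolding LH by auto
  ultimately show ?thesis
    unfolding LE by blast
qed

section \<open>From subbraces and ideals to boxes\<close>

lemma subbrace_lambda_closed:
  assumes L: "subbrace L B" and ab: "a \<in> L" "b \<in> L"
  shows "brace_lambda B a b \<in> L"
proof -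
  have add: "subgroup L (add_monoid B)" and mult: "subgroup L B"
    using L by (simp_all add: subbrace_def)
  have "b \<in> carrier B"
    using subgroup.subset [OF mult] ab by auto
  then show ?thesis
    using subgroup.m_closed [OF add] subgroup.m_inv_closed [OF add] subgroup.m_closed [OF mult] ab
    by (simp add: brace_lambda_def a_inv_def)
qed

text \<open>
  The first coordinate of a product or an inverse of elements \<open>(a, \<eta> c)\<close> involves \<open>\<lambda>\<close> only at
  arguments from \<open>L\<close>, and \<open>L\<close> is invariant under these: \<open>\<lambda>\<^sub>a b = - a + a b\<close>.
\<close>

lemma box_subgroup:
  assumes L: "subbrace L B"
  shows "subgroup (L \<times> \<eta> ` L) assocG"
proof -
  interpret G: group assocG
    by (rule assoc_group_is_group)
  have add: "subgroup L (add_monoid B)" and mult: "subgroup L B"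
    using L by (simp_all add: subbrace_def)
  have LB: "L \<subseteq> carrier B"
    using subgroup.subset [OF mult] .
  have sum: "a \<oplus> b \<in> L" if "a \<in> L" "b \<in> L" for a b
    using subgroup.m_closed [OF add] that by simp
  have minus: "\<ominus> a \<in> L" if "a \<in> L" for a
    using subgroup.m_inv_closed [OF add] that by (simp add: a_inv_def)
  show ?thesis
  proof (rule G.subgroupI)
    show "L \<times> \<eta> ` L \<subseteq> carrier assocG"
      using LB by (auto simp: assoc_carrier)
    show "L \<times> \<eta> ` L \<noteq> {}"
      using subgroup.one_closed [OF mult] by auto
  next
    fix x assume "x \<in> L \<times> \<eta> ` L"
    then obtain a c where x: "x = (a, \<eta> c)" "a \<in> L" "c \<in> L"
      by auto
    have c': "inv c \<in> L"
      using subgroup.m_inv_closed [OF mult x(3)] .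
    let ?y = "(brace_lambda B (inv c) (\<ominus> a), \<eta> (inv c))"
    have "?y \<otimes>\<^bsub>assocG\<^esub> x = \<one>\<^bsub>assocG\<^esub>"
      using x LB c' by (simp add: assoc_mult assoc_one subset_eq lambda_add [symmetric]
          lambda_zero eta.hom_mult [symmetric] del: eta.hom_mult eta.hom_inv)
    moreover have y: "?y \<in> L \<times> \<eta> ` L"
      using subbrace_lambda_closed [OF L] c' minus x by blast
    moreover have "?y \<in> carrier assocG" "x \<in> carrier assocG"
      using x y LB by (auto simp: assoc_carrier)
    ultimately show "inv\<^bsub>assocG\<^esub> x \<in> L \<times> \<eta> ` L"
      by (metis G.inv_equality)
  next
    fix x y assume "x \<in> L \<times> \<eta> ` L" "y \<in> L \<times> \<eta> ` L"
    then obtain a c b d where xy: "x = (a, \<eta> c)" "a \<in> L" "c \<in> L" "y = (b, \<eta> d)" "b \<in> L" "d \<in> L"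
      by auto
    then have "x \<otimes>\<^bsub>assocG\<^esub> y = (a \<oplus> brace_lambda B c b, \<eta> (c \<otimes> d))"
      using LB by (simp add: assoc_mult subset_eq)
    then show "x \<otimes>\<^bsub>assocG\<^esub> y \<in> L \<times> \<eta> ` L"
      using xy sum subbrace_lambda_closed [OF L] subgroup.m_closed [OF mult] by auto
  qed
qed

text \<open>
  The factorisations of \<open>(a, \<eta> c)\<close> in the whole group are \<open>(a, 1) (0, \<eta> c)\<close>,
  \<open>(a - c, 1) (c, \<eta> c)\<close> and \<open>(a, \<eta> a) (0, \<eta> (a\<inverse> c))\<close>. For \<open>a\<close> and \<open>c\<close> in \<open>L\<close> all
  factors stay in the box; the second uses the additive and the third the multiplicative
  closure of \<open>L\<close>.
\<close>

lemma box_trifactorised: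
  assumes L: "subbrace L B"
  shows "trifactorised_subgroup (L \<times> \<eta> ` L) assocG (assoc_K B E) (assoc_H B E \<eta>) (assoc_E B E)"
proof -
  let ?T = "L \<times> \<eta> ` L"
  have add: "subgroup L (add_monoid B)" and mult: "subgroup L B"
    using L by (simp_all add: subbrace_def)
  have LB: "L \<subseteq> carrier B"
    using subgroup.subset [OF mult] .
  have zero: "\<zero> \<in> L"
    using subgroup.one_closed [OF add] by simp
  have one: "\<one>\<^bsub>E\<^esub> \<in> \<eta> ` L"
    using subgroup.one_closed [OF mult] eta.hom_one by force
  have K: "(a, \<one>\<^bsub>E\<^esub>) \<in> ?T \<inter> assoc_K B E" if "a \<in> L" for a
    using that LB one by (auto simp: assoc_K_eq)
  have H: "(c, \<eta> c) \<in> ?T \<inter> assoc_H B E \<eta>" if "c \<in> L" for c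
    using that LB by (auto simp: assoc_H_eq)
  have E': "(\<zero>, \<eta> c) \<in> ?T \<inter> assoc_E B E" if "c \<in> L" for c
    using that LB zero by (auto simp: assoc_E_eq)
  have "x \<in> (?T \<inter> assoc_K B E) <#>\<^bsub>assocG\<^esub> (?T \<inter> assoc_E B E) \<and>
      x \<in> (?T \<inter> assoc_K B E) <#>\<^bsub>assocG\<^esub> (?T \<inter> assoc_H B E \<eta>) \<and>
      x \<in> (?T \<inter> assoc_H B E \<eta>) <#>\<^bsub>assocG\<^esub> (?T \<inter> assoc_E B E)" if x_in: "x \<in> ?T" for x
  proof -
    obtain a c where x: "x = (a, \<eta> c)" "a \<in> L" "c \<in> L"
      using x_in by auto
    then have B: "a \<in> carrier B" "c \<in> carrier B"
      using LB by auto
    have "a \<oplus> \<ominus> c \<in> L" "inv a \<otimes> c \<in> L"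
      using subgroup.m_closed [OF add] subgroup.m_inv_closed [OF add]
        subgroup.m_closed [OF mult] subgroup.m_inv_closed [OF mult] x by (simp_all add: a_inv_def)
    note in_L = this x(2,3)
    have "x = (a, \<one>\<^bsub>E\<^esub>) \<otimes>\<^bsub>assocG\<^esub> (\<zero>, \<eta> c)"
      using x B by (simp add: assoc_mult_add)
    moreover have "x = (a \<oplus> \<ominus> c, \<one>\<^bsub>E\<^esub>) \<otimes>\<^bsub>assocG\<^esub> (c, \<eta> c)"
      using x B by (simp add: assoc_mult_add A.m_assoc)
    moreover have "x = (a, \<eta> a) \<otimes>\<^bsub>assocG\<^esub> (\<zero>, \<eta> (inv a \<otimes> c))"
      using x B by (simp add: assoc_mult_quot E.m_assoc [symmetric])
    ultimately show ?thesis
      by (intro conjI) (erule set_multI; intro K H E' in_L)+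
  qed
  then show ?thesis
    using trifactorised_subgroup_iff [OF assoc_trifactorised box_subgroup [OF L]] by blast
qed

text \<open>
  Conjugating \<open>(l, \<eta> c)\<close> by \<open>(b, \<eta> a)\<close> gives \<open>(l', \<eta> d)\<close> with \<open>d = a c a\<inverse>\<close> and
  \<open>l' = b + \<lambda>\<^sub>a l - \<lambda>\<^sub>d b\<close>. The identity \<open>d b = b (b\<inverse> d b)\<close> reads \<open>d + \<lambda>\<^sub>d b = b + m\<close> with
  \<open>m = \<lambda>\<^sub>b (b\<inverse> d b)\<close> when both products are written additively. Eliminating \<open>\<lambda>\<^sub>d b\<close> turns \<open>l'\<close>
  into \<open>b + (\<lambda>\<^sub>a l - m) - b + d\<close>, which lies in \<open>L\<close>: multiplicative normality puts \<open>d\<close> and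
  \<open>b\<inverse> d b\<close> there, invariance under \<open>\<lambda>\<close> adds \<open>\<lambda>\<^sub>a l\<close> and \<open>m\<close>, and additive normality takes
  care of the conjugation by \<open>b\<close>.
\<close>

lemma box_normal:
  assumes L: "brace_ideal L B"
  shows "L \<times> \<eta> ` L \<lhd> assocG"
proof -
  interpret G: group assocG
    by (rule assoc_group_is_group)
  have nadd: "L \<lhd> add_monoid B" and nmult: "L \<lhd> B"
    and lam: "\<And>a b. \<lbrakk>a \<in> carrier B; b \<in> L\<rbrakk> \<Longrightarrow> brace_lambda B a b \<in> L"
    using L by (auto simp: brace_ideal_def)
  have add: "subgroup L (add_monoid B)"
    using nadd by (rule normal_imp_subgroup)
  have LB: "l \<in> carrier B" if "l \<in> L" for l
    using subgroup.subset [OF add] that by auto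
  have sum: "a \<oplus> b \<in> L" if "a \<in> L" "b \<in> L" for a b
    using subgroup.m_closed [OF add] that by simp
  have minus: "\<ominus> a \<in> L" if "a \<in> L" for a
    using subgroup.m_inv_closed [OF add] that by (simp add: a_inv_def)
  have conj_add: "b \<oplus> l \<oplus> \<ominus> b \<in> L" if "b \<in> carrier B" "l \<in> L" for b l
    using normal.inv_op_closed2 [OF nadd] that by (simp add: a_inv_def)
  have conj_mult: "b \<otimes> l \<otimes> inv b \<in> L" "inv b \<otimes> l \<otimes> b \<in> L" if "b \<in> carrier B" "l \<in> L" for b l
    using normal.inv_op_closed1 [OF nmult] normal.inv_op_closed2 [OF nmult] that by auto
  have "x \<otimes>\<^bsub>assocG\<^esub> t \<otimes>\<^bsub>assocG\<^esub> inv\<^bsub>assocG\<^esub> x \<in> L \<times> \<eta> ` L"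
    if x: "x \<in> carrier assocG" and t: "t \<in> L \<times> \<eta> ` L" for x t
  proof -
    obtain b a where xb: "x = (b, \<eta> a)" and B: "b \<in> carrier B" "a \<in> carrier B"
      using x by (rule assoc_elemE)
    obtain l c where tl: "t = (l, \<eta> c)" and lc: "l \<in> L" "c \<in> L"
      using t by auto
    define d where "d = a \<otimes> c \<otimes> inv a"
    define m where "m = brace_lambda B b (inv b \<otimes> d \<otimes> b)"
    define l' where "l' = (b \<oplus> (brace_lambda B a l \<oplus> \<ominus> m) \<oplus> \<ominus> b) \<oplus> d"
    have d: "d \<in> L"
      unfolding d_def by (rule conj_mult [OF B(2) lc(2)])
    have m: "m \<in> L"
      unfolding m_def by (rule lam [OF B(1) conj_mult(2) [OF B(1) d]])
    have l': "l' \<in> L"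
      unfolding l'_def by (intro sum conj_add lam minus B lc m d)
    have "d \<oplus> brace_lambda B d b = d \<otimes> b"
      using B d LB by (simp add: mult_eq_add_lambda)
    also have "\<dots> = b \<otimes> (inv b \<otimes> d \<otimes> b)"
      using B LB [OF d] by (simp add: M.m_assoc [symmetric])
    also have "\<dots> = b \<oplus> m"
      unfolding m_def
      using B LB [OF d] by (intro mult_eq_add_lambda) auto
    finally have key: "d \<oplus> brace_lambda B d b = b \<oplus> m" .
    have "l' \<oplus> brace_lambda B d b
        = (b \<oplus> (brace_lambda B a l \<oplus> \<ominus> m) \<oplus> \<ominus> b) \<oplus> (d \<oplus> brace_lambda B d b)"
      using B LB d m lc by (simp add: l'_def A.m_assoc lambda_closed)
    also have "\<dots> = b \<oplus> brace_lambda B a l"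
    proof -
      have "\<ominus> b \<oplus> (b \<oplus> m) = m"
        using B LB [OF m] by (simp add: A.m_assoc [symmetric])
      then show ?thesis
        unfolding key using B LB m lc by (simp add: A.m_assoc lambda_closed)
    qed
    finally have fst_eq: "l' \<oplus> brace_lambda B d b = b \<oplus> brace_lambda B a l" .
    have "d \<otimes> a = a \<otimes> c"
      using B LB lc by (simp add: d_def M.m_assoc)
    then have snd_eq: "\<eta> d \<otimes>\<^bsub>E\<^esub> \<eta> a = \<eta> a \<otimes>\<^bsub>E\<^esub> \<eta> c"
      using B LB lc d by (metis eta.hom_mult)
    have G: "t \<in> carrier assocG" "(l', \<eta> d) \<in> carrier assocG"
      using tl lc l' d LB by (auto simp: assoc_carrier)
    have "x \<otimes>\<^bsub>assocG\<^esub> t = (l', \<eta> d) \<otimes>\<^bsub>assocG\<^esub> x"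
      using xb tl B LB d by (simp add: assoc_mult fst_eq snd_eq)
    then have "x \<otimes>\<^bsub>assocG\<^esub> t \<otimes>\<^bsub>assocG\<^esub> inv\<^bsub>assocG\<^esub> x = (l', \<eta> d)"
      using x G by (simp add: G.m_assoc)
    then show ?thesis
      using l' d by simp
  qed
  then show ?thesis
    using box_subgroup [OF brace_ideal_imp_subbrace [OF L]] by (auto simp: G.normal_inv_iff)
qed

section \<open>From trifactorised subgroups to subbraces and ideals\<close>

text \<open>
  Each factorisation of \<open>T\<close> supplies one fact, by uniqueness of coordinates. Through
  \<open>K E\<close>, both coordinates of an element of \<open>T\<close> belong to \<open>T\<close> on their own. Through \<open>K H\<close>,
  every second coordinate is \<open>\<eta> c\<close> for some \<open>(c, \<eta> c)\<close> in \<open>T\<close>, so with \<open>c\<close> in \<open>L\<close>.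
  Through \<open>H E\<close>, each \<open>(c, 1)\<close> in \<open>T\<close> forces \<open>(c, \<eta> c)\<close>, and hence \<open>(0, \<eta> c)\<close>, into \<open>T\<close>.
\<close>

lemma trifactorised_subgroup_is_box:
  assumes tri: "trifactorised_subgroup T assocG (assoc_K B E) (assoc_H B E \<eta>) (assoc_E B E)"
  defines "L \<equiv> {b \<in> carrier B. embed_add E b \<in> T}"
  shows "T = L \<times> \<eta> ` L"
proof -
  have T: "subgroup T assocG"
    using tri by (simp add: trifactorised_subgroup_def)
  note fact = trifactorised_subgroup_iff [OF assoc_trifactorised T, THEN iffD1, OF tri]
  have L: "a \<in> carrier B" "(a, \<one>\<^bsub>E\<^esub>) \<in> T" if "a \<in> L" for a
    using that by (auto simp: L_def embed_add_def)
  have KE: "a \<in> L \<and> (\<zero>, e) \<in> T \<and> e \<in> carrier E" if "(a, e) \<in> T" for a e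
  proof -
    have "(a, e) \<in> (T \<inter> assoc_K B E) <#>\<^bsub>assocG\<^esub> (T \<inter> assoc_E B E)"
      using fact that by blast
    then obtain b f where "(b, \<one>\<^bsub>E\<^esub>) \<in> T" "b \<in> carrier B" "(\<zero>, f) \<in> T" "f \<in> carrier E"
      "(a, e) = (b, \<one>\<^bsub>E\<^esub>) \<otimes>\<^bsub>assocG\<^esub> (\<zero>, f)"
      by (auto simp: set_mult_def assoc_K_eq assoc_E_eq)
    then show ?thesis
      by (simp add: assoc_mult_add L_def embed_add_def)
  qed
  have quot_sub: "e \<in> \<eta> ` L" if "(a, e) \<in> T" for a e
  proof -
    have "(a, e) \<in> (T \<inter> assoc_K B E) <#>\<^bsub>assocG\<^esub> (T \<inter> assoc_H B E \<eta>)"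
      using fact that by blast
    then obtain b c where "(c, \<eta> c) \<in> T" "c \<in> carrier B" "(a, e) = (b, \<one>\<^bsub>E\<^esub>) \<otimes>\<^bsub>assocG\<^esub> (c, \<eta> c)"
      by (auto simp: set_mult_def assoc_K_eq assoc_H_eq)
    then show ?thesis
      using KE by (simp add: assoc_mult_add)
  qed
  have graph: "(c, \<eta> c) \<in> T" if "c \<in> L" for c
  proof -
    have "(c, \<one>\<^bsub>E\<^esub>) \<in> (T \<inter> assoc_H B E \<eta>) <#>\<^bsub>assocG\<^esub> (T \<inter> assoc_E B E)"
      using fact L(2) [OF that] by blast
    then obtain d f where "(d, \<eta> d) \<in> T" "d \<in> carrier B" "f \<in> carrier E"
      "(c, \<one>\<^bsub>E\<^esub>) = (d, \<eta> d) \<otimes>\<^bsub>assocG\<^esub> (\<zero>, f)"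
      by (auto simp: set_mult_def assoc_H_eq assoc_E_eq)
    then show ?thesis
      by (simp add: assoc_mult_quot)
  qed
  show ?thesis
  proof
    show "T \<subseteq> L \<times> \<eta> ` L"
      using KE quot_sub by auto
    show "L \<times> \<eta> ` L \<subseteq> T"
    proof
      fix x assume "x \<in> L \<times> \<eta> ` L"
      then obtain a c where x: "x = (a, \<eta> c)" "a \<in> L" "c \<in> L"
        by auto
      have "(a, \<one>\<^bsub>E\<^esub>) \<otimes>\<^bsub>assocG\<^esub> (\<zero>, \<eta> c) \<in> T"
        using subgroup.m_closed [OF T L(2)] KE [OF graph] x by blast
      then show "x \<in> T"
        using x L by (simp add: assoc_mult_add)
    qed
  qed
qed

text \<open>
  This exhibits the additively defined \<open>L\<close> as a preimage under the multiplicative homomorphism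
  \<open>c \<mapsto> (c, \<eta> c)\<close> as well, so that one set inherits both subgroup structures from \<open>T\<close>.
\<close>

lemma box_graph_preimage:
  assumes "L \<subseteq> carrier B"
  shows "{c \<in> carrier B. (c, \<eta> c) \<in> L \<times> \<eta> ` L} = L"
  using assms by auto

lemma trifactorised_subgroup_imp_subbrace:
  assumes tri: "trifactorised_subgroup T assocG (assoc_K B E) (assoc_H B E \<eta>) (assoc_E B E)"
  shows "subbrace {b \<in> carrier B. embed_add E b \<in> T} B"
proof -
  have T: "subgroup T assocG"
    using tri by (simp add: trifactorised_subgroup_def)
  show ?thesis
    using group_hom.subgroup_preimage [OF embed_add_group_hom T]
      group_hom.subgroup_preimage [OF graph_group_hom T]
      box_graph_preimage [of "{b \<in> carrier B. embed_add E b \<in> T}"]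
      trifactorised_subgroup_is_box [OF tri]
    by (simp add: subbrace_def)
qed

text \<open>
  Both normality conditions pass to the two preimages. Invariance under \<open>\<lambda>\<close> holds because
  conjugation by \<open>(0, \<eta> a)\<close> acts on the copy of the additive group as \<open>\<lambda>\<^sub>a\<close>.
\<close>

lemma normal_trifactorised_subgroup_imp_ideal:
  assumes tri: "trifactorised_subgroup T assocG (assoc_K B E) (assoc_H B E \<eta>) (assoc_E B E)"
    and T: "T \<lhd> assocG"
  shows "brace_ideal {b \<in> carrier B. embed_add E b \<in> T} B"
proof -
  interpret G: group assocG
    by (rule assoc_group_is_group)
  have "embed_add E (brace_lambda B a l) \<in> T"
    if a: "a \<in> carrier B" and l: "l \<in> carrier B" "embed_add E l \<in> T" for a l
  proof -
    let ?x = "(\<zero>, \<eta> a)"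
    have G: "?x \<in> carrier assocG" "embed_add E l \<in> carrier assocG"
      "embed_add E (brace_lambda B a l) \<in> carrier assocG"
      using a l by (simp_all add: assoc_carrier embed_add_def lambda_closed)
    have "?x \<otimes>\<^bsub>assocG\<^esub> embed_add E l = embed_add E (brace_lambda B a l) \<otimes>\<^bsub>assocG\<^esub> ?x"
      using a l by (simp add: embed_add_def assoc_mult assoc_mult_add lambda_closed)
    then have "embed_add E (brace_lambda B a l)
        = ?x \<otimes>\<^bsub>assocG\<^esub> embed_add E l \<otimes>\<^bsub>assocG\<^esub> inv\<^bsub>assocG\<^esub> ?x"
      using G by (simp add: G.m_assoc)
    then show ?thesis
      using normal.inv_op_closed2 [OF T G(1) l(2)] by simp
  qed
  then show ?thesis
    using group_hom.normal_preimage [OF embed_add_group_hom T]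
      group_hom.normal_preimage [OF graph_group_hom T]
      box_graph_preimage [of "{b \<in> carrier B. embed_add E b \<in> T}"]
      trifactorised_subgroup_is_box [OF tri]
    by (auto simp: brace_ideal_def lambda_closed)
qed

end

section \<open>The correspondence\<close>

theorem proposition5p10:
  fixes B :: "('b, 'm) ring_scheme"
    and E :: "('e, 'n) monoid_scheme"
    and \<eta> :: "'b \<Rightarrow> 'e"
    and G :: "('b \<times> 'e) monoid"
    and K\<^sub>G H\<^sub>G E\<^sub>G :: "('b \<times> 'e) set"
    and \<Phi> :: "'b set \<Rightarrow> ('b \<times> 'e) set"
  assumes "brace_trifactorisation B E \<eta>"
    and "G = assoc_group B E \<eta>"
    and "K\<^sub>G = assoc_K B E" and "H\<^sub>G = assoc_H B E \<eta>" and "E\<^sub>G = assoc_E B E"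
    and "\<And>L. \<Phi> L = (embed_add E ` L <#>\<^bsub>G\<^esub> H\<^sub>G) \<inter> (embed_add E ` L <#>\<^bsub>G\<^esub> E\<^sub>G)"
  shows "bij_betw \<Phi> {L. subbrace L B} {T. trifactorised_subgroup T G K\<^sub>G H\<^sub>G E\<^sub>G} \<and>
    bij_betw \<Phi> {L. brace_ideal L B} {T. trifactorised_subgroup T G K\<^sub>G H\<^sub>G E\<^sub>G \<and> T \<lhd> G}"
proof -
  interpret brace_trifactorisation B E \<eta>
    by (rule assms(1))
  let ?tri = "\<lambda>T. trifactorised_subgroup T G K\<^sub>G H\<^sub>G E\<^sub>G"
  let ?L = "\<lambda>T. {b \<in> carrier B. embed_add E b \<in> T}"
  note defs = assms(2-5)
  have box: "\<Phi> L = L \<times> \<eta> ` L" if "subbrace L B" for L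
    using that LH_Int_LE_eq unfolding assms(6) defs by (simp add: subbrace_def)
  have \<Phi>_tri: "?tri (\<Phi> L)" if "subbrace L B" for L
    using box_trifactorised [OF that] by (simp add: box that defs)
  have \<Phi>_normal: "\<Phi> L \<lhd> G" if "brace_ideal L B" for L
    using box_normal [OF that] by (simp add: box brace_ideal_imp_subbrace that defs)
  have sub: "subbrace (?L T) B" if "?tri T" for T
    using trifactorised_subgroup_imp_subbrace that by (simp add: defs)
  have ideal: "brace_ideal (?L T) B" if "?tri T" "T \<lhd> G" for T
    using normal_trifactorised_subgroup_imp_ideal that by (simp add: defs)
  have \<Phi>_L: "\<Phi> (?L T) = T" if "?tri T" for T
    using trifactorised_subgroup_is_box [of T] that sub [OF that] by (simp add: box defs)
  have L_\<Phi>: "?L (\<Phi> L) = L" if L: "subbrace L B" for L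
  proof -
    have "L \<subseteq> carrier B" "\<one>\<^bsub>B\<^esub> \<in> L"
      using L by (auto simp: subbrace_def dest: subgroup.subset subgroup.one_closed)
    then show ?thesis
      using eta.hom_one by (force simp: box [OF L] embed_add_def)
  qed
  have "bij_betw \<Phi> {L. subbrace L B} {T. ?tri T}"
    by (rule bij_betw_byWitness [where f' = ?L]) (auto simp: L_\<Phi> \<Phi>_L \<Phi>_tri sub)
  moreover have "bij_betw \<Phi> {L. brace_ideal L B} {T. ?tri T \<and> T \<lhd> G}"
    by (rule bij_betw_byWitness [where f' = ?L])
      (auto simp: L_\<Phi> \<Phi>_L \<Phi>_tri \<Phi>_normal ideal brace_ideal_imp_subbrace)
  ultimately show ?thesis
    by blast
qed

end
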